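(* Let $N,n\ge 1$ be integers. For each $i\in\{1,\dots,N\}$ let $\mathcal X^i\subseteq\mathbb R^n$ be non-empty, compact and convex, and let $f_\circ^i$ be a function on $\mathbb R^n$ with values in $\mathbb R\cup\{+\infty\}$ such that $f^i:=f_\circ^i+\iota_{\mathcal X^i}:\mathbb R^n\to\mathbb R\cup\{+\infty\}$ is proper, lower semi-continuous and convex. Let $P=[a_{i,j}]\in\mathbb R^{N\times N}$ be a row-stochastic matrix ($a_{i,j}\ge 0$ for all $i,j$ and $\sum_{j=1}^N a_{i,j}=1$ for all $i$) with $\min_i a_{i,i}>0$ and such that the associated weighted digraph is strongly connected. Put $\boldsymbol A:=P\otimes I_n$, $\mathcal X:=\mathcal X^1\times\cdots\times\mathcal X^N$ and $\boldsymbol f(\boldsymbol x):=\sum_{i=1}^N f^i(x^i)$. Let $\eta\in(0,1)$ and let $\tilde Q\in\mathbb R^{N\times N}$ be a symmetric positive definite matrix satisfying the linear matrix inequality $$P^\top\tilde Q P\preccurlyeq(2\eta-1)\tilde Q+(1-\eta)\big(P^\top\tilde Q+\tilde Q P\big).$$ Then, with $\boldsymbol Q:=\tilde Q\otimes I_n$, for every $\boldsymbol x(0)\in\mathcal X$ the sequence $(\boldsymbol x(k))_{k=0}^\infty$ generated by $$\boldsymbol x(k+1)=\mathrm{prox}_{\boldsymbol f}^{\boldsymbol Q}\big(\boldsymbol A\,\boldsymbol x(k)\big),\qquad k\in\mathbb N,$$ converges to a network equilibrium, i.e. to a point of $\mathrm{fix}\big(\mathrm{prox}_{\boldsymbol f}^{\boldsymbol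 Q}\circ\boldsymbol A\big)$.
   Context: Collective vectors are written $\boldsymbol x=[x^1;\dots;x^N]\in\mathbb R^{nN}$ with $x^i\in\mathbb R^n$. $\iota_{\mathcal C}$ is the indicator function ($0$ on $\mathcal C$, $+\infty$ elsewhere). For a symmetric positive definite matrix $Q$, $\|x\|_Q:=\sqrt{x^\top Qx}$, and for a proper lower semi-continuous convex function $f$, $\mathrm{prox}_f^Q(x):=\mathrm{argmin}_y\, f(y)+\tfrac12\|x-y\|_Q^2$ (a single point). $\mathrm{fix}(T)$ denotes the set of fixed points of a map $T$. $\otimes$ is the Kronecker product; $B\preccurlyeq C$ for symmetric matrices means $C-B$ is positive semidefinite. The weighted digraph associated with $P$ has nodes $1,\dots,N$, with an edge between $i$ and $j$ (in a fixed direction convention) exactly when $a_{i,j}\ne 0$. If $\boldsymbol Q=\mathrm{diag}(Q_1,\dots,Q_N)$ is block-diagonal with $n\times n$ blocks $Q_i\succ 0$, then $\mathrm{prox}_{\boldsymbol f}^{\boldsymbol Q}(\boldsymbol z)=[\mathrm{prox}_{f^1}^{Q_1}(z^1);\dots;\mathrm{prox}_{f^N}^{Q_N}(z^N)]$. In that case $\overline{\boldsymbol x}$ is a fixed point of $\mathrm{prox}_{\boldsymbol f}^{\boldsymbol Q}\circ\boldsymbol A$ if and only if $\overline x^i\in\mathrm{argmin}_{y\in\mathcal X^i} f_\circ^i(y)+\tfrac12\|y-\sum_{j=1}^N a_{i,j}\overline x^j\|_{Q_i}^2$ for every $i$, which is the definition of a network equilibrium. For general $\boldsymbol Q\succ0$,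 a network equilibrium is understood as a point of $\mathrm{fix}(\mathrm{prox}_{\boldsymbol f}^{\boldsymbol Q}\circ\boldsymbol A)$. *)

theory Defs
  imports "HOL-Analysis.Analysis" "Graph_Theory.Digraph_Component"
begin

definition positive_definite :: "real^'d^'d \<Rightarrow> bool" where
  "positive_definite Q \<longleftrightarrow> transpose Q = Q \<and> (\<forall>x. x \<noteq> 0 \<longrightarrow> 0 < x \<bullet> (Q *v x))"

definition positive_semidefinite :: "real^'d^'d \<Rightarrow> bool" where
  "positive_semidefinite Q \<longleftrightarrow> transpose Q = Q \<and> (\<forall>x. 0 \<le> x \<bullet> (Q *v x))"

definition loewner_le :: "real^'d^'d \<Rightarrow> real^'d^'d \<Rightarrow> bool"  (infix "\<preceq>\<^sub>L" 50) where
  "B \<preceq>\<^sub>L C \<longleftrightarrow> positive_semidefinite (C - B)"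

(* The pair (i, k) is the index of entry k in block i. *)
definition kronecker :: "real^'b^'a \<Rightarrow> real^'d^'c \<Rightarrow> real^('b \<times> 'd)^('a \<times> 'c)"  (infixr "\<otimes>\<^sub>K" 70) where
  "B \<otimes>\<^sub>K C = (\<chi> p q. B $ fst p $ fst q * C $ snd p $ snd q)"

(* A vector in R^(nN) is indexed by pairs (i, k); block x i is its i-th component x^i in R^n. *)
definition block :: "real^('N::finite \<times> 'n::finite) \<Rightarrow> 'N \<Rightarrow> real^'n" where
  "block x i = (\<chi> k. x $ (i, k))"

definition row_stochastic :: "real^'N^'N \<Rightarrow> bool" where
  "row_stochastic P \<longleftrightarrow> (\<forall>i j. 0 \<le> P $ i $ j) \<and> (\<forall>i. (\<Sum>j\<in>UNIV. P $ i $ j) = 1)"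

definition matrix_digraph :: "real^'N^'N \<Rightarrow> ('N, 'N \<times> 'N) pre_digraph" where
  "matrix_digraph P = with_proj \<lparr>pverts = UNIV, parcs = {(i, j). P $ i $ j \<noteq> 0}\<rparr>"

(* The convex-analysis indicator (0 or infinity), not the library's 0/1-valued one. *)
definition indicator_fun :: "'a set \<Rightarrow> 'a \<Rightarrow> ereal" where
  "indicator_fun C x = (if x \<in> C then 0 else \<infinity>)"

definition proper_fun :: "('a \<Rightarrow> ereal) \<Rightarrow> bool" where
  "proper_fun f \<longleftrightarrow> (\<forall>x. f x \<noteq> -\<infinity>) \<and> (\<exists>x. f x \<noteq> \<infinity>)"

definition lower_semicontinuous :: "('a::topological_space \<Rightarrow> ereal) \<Rightarrow> bool" where
  "lower_semicontinuous f \<longleftrightarrow> (\<forall>x. f x \<le> Liminf (at x) f)"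

(* The library's convex_on is restricted to real-valued functions; here 0 * \<infinity> = 0. *)
definition convex_fun :: "('a::real_vector \<Rightarrow> ereal) \<Rightarrow> bool" where
  "convex_fun f \<longleftrightarrow> (\<forall>x y. \<forall>u\<ge>0. \<forall>v\<ge>0. u + v = 1 \<longrightarrow>
     f (u *\<^sub>R x + v *\<^sub>R y) \<le> ereal u * f x + ereal v * f y)"

definition norm_wrt :: "real^'d^'d \<Rightarrow> real^'d \<Rightarrow> real" where
  "norm_wrt Q x = sqrt (x \<bullet> (Q *v x))"

(* Meaningful when the minimizer is unique, as it is for Q positive definite and f proper,
   lower semicontinuous and convex. *)
definition prox :: "real^'d^'d \<Rightarrow> (real^'d \<Rightarrow> ereal) \<Rightarrow> real^'d \<Rightarrow> real^'d" where
  "prox Q f x = (THE y. is_arg_min (\<lambda>y. f y + ereal (1/2 * (norm_wrt Q (x - y))\<^sup>2)) (\<lambda>_. True) y)"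

definition fixed_points :: "('a \<Rightarrow> 'a) \<Rightarrow> 'a set" where
  "fixed_points T = {x. T x = x}"

definition network_equilibria ::
  "real^'d^'d \<Rightarrow> (real^'d \<Rightarrow> ereal) \<Rightarrow> real^'d^'d \<Rightarrow> (real^'d) set" where
  "network_equilibria Q f A = fixed_points (prox Q f \<circ> (\<lambda>x. A *v x))"

definition local_cost :: "(real^'n \<Rightarrow> ereal) \<Rightarrow> (real^'n) set \<Rightarrow> real^'n \<Rightarrow> ereal" where
  "local_cost f X y = f y + indicator_fun X y"

definition collective_cost ::
  "('N::finite \<Rightarrow> real^'n::finite \<Rightarrow> ereal) \<Rightarrow> ('N \<Rightarrow> (real^'n) set) \<Rightarrow> real^('N \<times> 'n) \<Rightarrow> ereal" where
  "collective_cost f X x = (\<Sum>i\<in>UNIV. local_cost (f i) (X i) (block x i))"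

end

theory Submission
  imports Defs
begin

text \<open>The matrix inequality says that \<open>P\<close>, hence also its Kronecker product with the identity, is
  \<open>\<eta>\<close>-averaged in the norm of the weight matrix, while the proximal map in the same norm is firmly
  nonexpansive. At a fixed point \<open>z\<close> of the composition \<open>T\<close> the squared distance of the iterates
  to \<open>z\<close> therefore decreases by at least a multiple of the squared residual \<open>x - T x\<close>. A fixed
  point exists by Brouwer's theorem, because \<open>T\<close> is continuous with values in the compact convex
  set of feasible points. The residual vanishes along the iteration, so every cluster point is
  again a fixed point, and the distance to that cluster point is monotone with a subsequence
  tending to zero.\<close>

section \<open>Quadratic forms of positive definite matrices\<close>

lemma positive_definite_sym:
  assumes "positive_definite Q"
  shows "x \<bullet> (Q *v y) = y \<bullet> (Q *v x)"
  using assms unfolding positive_definite_def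
  by (metis dot_lmul_matrix inner_commute transpose_matrix_vector)

lemma positive_definite_nonneg:
  assumes "positive_definite Q"
  shows "0 \<le> x \<bullet> (Q *v x)"
  using assms unfolding positive_definite_def by (cases "x = 0") (auto intro: less_imp_le)

lemma positive_definite_eq_0_iff:
  assumes "positive_definite Q"
  shows "x \<bullet> (Q *v x) = 0 \<longleftrightarrow> x = 0"
  using assms unfolding positive_definite_def by (cases "x = 0") fastforce+

lemma norm_wrt_power2:
  assumes "positive_definite Q"
  shows "(norm_wrt Q x)\<^sup>2 = x \<bullet> (Q *v x)"
  unfolding norm_wrt_def using positive_definite_nonneg[OF assms] by simp

lemma quadratic_form_diff:
  assumes "positive_definite Q"
  shows "(x - y) \<bullet> (Q *v (x - y)) = x \<bullet> (Q *v x) - 2 * (x \<bullet> (Q *v y)) + y \<bullet> (Q *v y)"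
  using positive_definite_sym[OF assms, of x y]
  by (simp add: matrix_vector_mult_diff_distrib inner_diff_left inner_diff_right)

text \<open>By the parallelogram identity the two sides differ by the form at
  \<open>x - y\<close>.\<close>

lemma quadratic_form_add_le:
  assumes "positive_definite Q"
  shows "(x + y) \<bullet> (Q *v (x + y)) \<le> 2 * (x \<bullet> (Q *v x)) + 2 * (y \<bullet> (Q *v y))"
  using positive_definite_nonneg[OF assms, of "x - y"] positive_definite_sym[OF assms, of x y]
  by (simp add: matrix_vector_mult_diff_distrib matrix_vector_right_distrib
      inner_diff_left inner_diff_right inner_add_left inner_add_right)

text \<open>The constant is the minimum of the form over the unit sphere, attained by compactness;
  homogeneity of degree two carries the bound to all vectors.\<close>

lemma positive_definite_coercive:
  fixes Q :: "real^'d^'d"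
  assumes "positive_definite Q"
  obtains c where "0 < c" "\<And>x. c * (norm x)\<^sup>2 \<le> x \<bullet> (Q *v x)"
proof -
  have "continuous_on (sphere 0 1) (\<lambda>x. x \<bullet> (Q *v x))"
    by (intro continuous_intros matrix_vector_mult_linear_continuous_on)
  moreover have "sphere (0 :: real^'d) 1 \<noteq> {}" by simp
  ultimately obtain w where w: "w \<in> sphere 0 1"
      and w_min: "\<And>x. x \<in> sphere 0 1 \<Longrightarrow> w \<bullet> (Q *v w) \<le> x \<bullet> (Q *v x)"
    using continuous_attains_inf[OF compact_sphere, of 0 1 "\<lambda>x. x \<bullet> (Q *v x)"] by auto
  show thesis
  proof
    show "0 < w \<bullet> (Q *v w)"
      using w assms by (metis positive_definite_def dist_0_norm mem_sphere norm_zero zero_neq_one)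
    fix x :: "real^'d"
    show "w \<bullet> (Q *v w) * (norm x)\<^sup>2 \<le> x \<bullet> (Q *v x)"
    proof (cases "x = 0")
      case False
      then have "w \<bullet> (Q *v w) \<le> (x /\<^sub>R norm x) \<bullet> (Q *v (x /\<^sub>R norm x))"
        by (intro w_min) simp
      also have "\<dots> = x \<bullet> (Q *v x) / (norm x)\<^sup>2"
        by (simp add: matrix_vector_mult_scaleR power2_eq_square field_simps)
      finally show ?thesis using False by (simp add: pos_le_divide_eq)
    qed simp
  qed
qed

section \<open>Lower semicontinuity and convexity of extended-real functions\<close>

text \<open>The punctured filter of the definition may be replaced by \<open>nhds x\<close>, since
  the premise \<open>c < f x\<close> covers the point itself. This makes sums and compositions a
  matter of eventual statements.\<close>

lemma lower_semicontinuous_iff: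
  "lower_semicontinuous f \<longleftrightarrow> (\<forall>x c. c < f x \<longrightarrow> (\<forall>\<^sub>F y in nhds x. c < f y))"
  unfolding lower_semicontinuous_def le_Liminf_iff eventually_nhds_conv_at by blast

lemma lower_semicontinuous_continuous:
  fixes f :: "'a::topological_space \<Rightarrow> ereal"
  assumes "continuous_on UNIV f"
  shows "lower_semicontinuous f"
  unfolding lower_semicontinuous_iff
proof (intro allI impI)
  fix x c assume "c < f x"
  have "(f \<longlongrightarrow> f x) (nhds x)"
    using assms by (simp add: continuous_on_def tendsto_at_iff_tendsto_nhds)
  then show "\<forall>\<^sub>F y in nhds x. c < f y" using \<open>c < f x\<close> by (rule order_tendstoD)
qed

lemma lower_semicontinuous_compose:
  assumes "lower_semicontinuous f" "continuous_on UNIV g"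
  shows "lower_semicontinuous (\<lambda>x. f (g x))"
  unfolding lower_semicontinuous_iff
proof (intro allI impI)
  fix x c assume "c < f (g x)"
  then have "\<forall>\<^sub>F y in nhds (g x). c < f y"
    using assms(1) by (simp add: lower_semicontinuous_iff)
  moreover have "filterlim g (nhds (g x)) (nhds x)"
    using assms(2) by (simp add: continuous_on_def tendsto_at_iff_tendsto_nhds)
  ultimately show "\<forall>\<^sub>F y in nhds x. c < f (g y)"
    by (rule eventually_compose_filterlim)
qed

text \<open>This splits a lower bound for a sum into bounds for the summands, so that lower
  semicontinuity passes to sums. The value \<open>-\<infinity>\<close> is excluded because
  \<open>\<infinity> + (-\<infinity>) = \<infinity>\<close>, while nothing lies below
  \<open>-\<infinity>\<close>.\<close>

lemma ereal_less_add_split: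
  fixes a b c :: ereal
  assumes "c < a + b" "a \<noteq> -\<infinity>" "b \<noteq> -\<infinity>"
  obtains r s where "r < a" "s < b" "c \<le> r + s"
proof -
  obtain d where d: "c < d" "d < a + b" using assms(1) dense by blast
  then obtain e where e: "d = ereal e" by (cases d) auto
  consider (fin) u v where "a = ereal u" "b = ereal v" | (a_inf) "a = \<infinity>" | (b_inf) "b = \<infinity>"
    using assms by (cases a; cases b) auto
  then show thesis
  proof cases
    case fin
    \<comment> \<open>Half of the slack between \<open>a + b\<close> and \<open>d\<close>: each
      summand gives up one half, so the lowered summands add up to exactly \<open>e\<close>.\<close>
    define \<epsilon> where "\<epsilon> = (u + v - e) / 2"
    have "0 < \<epsilon>" using d fin e by (simp add: \<epsilon>_def)
    moreover have "e = (u - \<epsilon>) + (v - \<epsilon>)" by (simp add: \<epsilon>_def field_simps)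
    ultimately show thesis
      using fin d(1) e by (intro that[of "ereal (u - \<epsilon>)" "ereal (v - \<epsilon>)"]) auto
  next
    case a_inf
    obtain s where s: "ereal s < b" using assms(3) ereal_dense2[of "-\<infinity>" b] by auto
    show thesis
      using a_inf s d(1) e by (intro that[of "ereal (e - s)" "ereal s"]) auto
  next
    case b_inf
    obtain s where s: "ereal s < a" using assms(2) ereal_dense2[of "-\<infinity>" a] by auto
    show thesis
      using b_inf s d(1) e by (intro that[of "ereal s" "ereal (e - s)"]) auto
  qed
qed

lemma lower_semicontinuous_add:
  assumes "lower_semicontinuous f" "lower_semicontinuous g"
    and "\<And>x. f x \<noteq> -\<infinity>" "\<And>x. g x \<noteq> -\<infinity>"
  shows "lower_semicontinuous (\<lambda>x. f x + g x)"
  unfolding lower_semicontinuous_iff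
proof (intro allI impI)
  fix x c assume "c < f x + g x"
  then obtain r s where rs: "r < f x" "s < g x" "c \<le> r + s"
    using ereal_less_add_split assms(3,4) by metis
  then have "\<forall>\<^sub>F y in nhds x. r < f y \<and> s < g y"
    using assms(1,2) by (auto simp: lower_semicontinuous_iff eventually_conj_iff)
  then show "\<forall>\<^sub>F y in nhds x. c < f y + g y"
    by (rule eventually_mono) (use rs(3) ereal_add_strict_mono2 in \<open>blast intro: le_less_trans\<close>)
qed

lemma sum_not_MInfty:
  fixes f :: "'i \<Rightarrow> ereal"
  assumes "\<And>i. i \<in> I \<Longrightarrow> f i \<noteq> -\<infinity>"
  shows "sum f I \<noteq> -\<infinity>"
  using assms by (induction I rule: infinite_finite_induct) auto

lemma lower_semicontinuous_sum:
  fixes f :: "'i \<Rightarrow> 'a::topological_space \<Rightarrow> ereal"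
  assumes "\<And>i. i \<in> I \<Longrightarrow> lower_semicontinuous (f i)"
    and "\<And>i x. i \<in> I \<Longrightarrow> f i x \<noteq> -\<infinity>"
  shows "lower_semicontinuous (\<lambda>x. \<Sum>i\<in>I. f i x)"
  using assms
proof (induction I rule: infinite_finite_induct)
  case (insert i I)
  have "lower_semicontinuous (\<lambda>x. f i x + (\<Sum>i\<in>I. f i x))"
    using insert by (intro lower_semicontinuous_add sum_not_MInfty) auto
  then show ?case using insert.hyps by simp
qed (auto simp: lower_semicontinuous_iff)

lemma convex_fun_sum:
  fixes f :: "'i \<Rightarrow> 'a::real_vector \<Rightarrow> ereal"
  assumes "\<And>i. i \<in> I \<Longrightarrow> convex_fun (f i)"
  shows "convex_fun (\<lambda>x. \<Sum>i\<in>I. f i x)"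
  unfolding convex_fun_def
proof (intro allI impI)
  fix x y :: 'a and u v :: real
  assume uv: "0 \<le> u" "0 \<le> v" "u + v = 1"
  \<comment> \<open>A finite nonnegative factor distributes over sums of extended reals, even when
    infinite terms occur.\<close>
  have distrib: "ereal t * (\<Sum>i\<in>I. g i) = (\<Sum>i\<in>I. ereal t * g i)"
    if "0 \<le> t" for t and g :: "'i \<Rightarrow> ereal"
    by (induction I rule: infinite_finite_induct) (use that in \<open>auto simp: ereal_pos_distrib\<close>)
  have "(\<Sum>i\<in>I. f i (u *\<^sub>R x + v *\<^sub>R y)) \<le> (\<Sum>i\<in>I. ereal u * f i x + ereal v * f i y)"
    using assms uv by (intro sum_mono) (auto simp: convex_fun_def)
  then show "(\<Sum>i\<in>I. f i (u *\<^sub>R x + v *\<^sub>R y))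
      \<le> ereal u * (\<Sum>i\<in>I. f i x) + ereal v * (\<Sum>i\<in>I. f i y)"
    by (simp add: distrib uv sum.distrib)
qed

text \<open>Without a minimum, every \<open>y\<close> has some \<open>z y\<close> of smaller value,
  and \<open>f\<close> still exceeds \<open>f (z y)\<close> on a neighbourhood \<open>U y\<close>.
  In a finite subcover choose the centre \<open>m\<close> with least \<open>f (z m)\<close>: the
  point \<open>z m\<close> lies in some \<open>U y\<close>, so \<open>f (z y) < f (z m)\<close>, a
  contradiction.\<close>

lemma lower_semicontinuous_attains_inf:
  fixes f :: "'a::topological_space \<Rightarrow> ereal"
  assumes "lower_semicontinuous f" "compact S" "S \<noteq> {}"
  obtains p where "p \<in> S" "\<And>y. y \<in> S \<Longrightarrow> f p \<le> f y"
proof (rule ccontr)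
  assume "\<not> thesis"
  then have "\<forall>y\<in>S. \<exists>z\<in>S. f z < f y" using that by (meson not_le)
  then obtain z where z: "\<And>y. y \<in> S \<Longrightarrow> z y \<in> S" "\<And>y. y \<in> S \<Longrightarrow> f (z y) < f y" by metis
  have "\<exists>U. open U \<and> y \<in> U \<and> (\<forall>w\<in>U. f (z y) < f w)" if "y \<in> S" for y
    using assms(1) z(2)[OF that] unfolding lower_semicontinuous_iff eventually_nhds by blast
  then obtain U where U: "\<And>y. y \<in> S \<Longrightarrow> open (U y)" "\<And>y. y \<in> S \<Longrightarrow> y \<in> U y"
      "\<And>y w. y \<in> S \<Longrightarrow> w \<in> U y \<Longrightarrow> f (z y) < f w"
    by metis
  have "S \<subseteq> \<Union> (U ` S)" using U(2) by blast
  then obtain C where C: "C \<subseteq> S" "finite C" "S \<subseteq> \<Union> (U ` C)"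
    using compactE_image[OF assms(2), of S U] U(1) by metis
  then have "C \<noteq> {}" using assms(3) by auto
  define m where "m = arg_min_on (f \<circ> z) C"
  have m: "m \<in> C" "\<And>y. y \<in> C \<Longrightarrow> f (z m) \<le> f (z y)"
    using arg_min_if_finite(1)[OF C(2) \<open>C \<noteq> {}\<close>, of "f \<circ> z"]
      arg_min_least[OF C(2) \<open>C \<noteq> {}\<close>, of _ "f \<circ> z"] by (simp_all add: m_def)
  moreover obtain y where "y \<in> C" "z m \<in> U y" using m(1) C z(1) by blast
  ultimately show False using U(3) C(1) by (meson not_le subsetD)
qed

section \<open>The proximal map in a weighted norm\<close>

text \<open>First-order optimality: \<open>Q *v (a - p)\<close> is a subgradient of \<open>g\<close>
  at \<open>p\<close>, tested at points of finite value. It follows by perturbing \<open>p\<close>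
  towards \<open>y\<close>.\<close>

lemma prox_variational_ineq:
  fixes g :: "real^'d \<Rightarrow> ereal"
  assumes Q: "positive_definite Q" and g: "convex_fun g"
    and min: "is_arg_min (\<lambda>y. g y + ereal (1/2 * (norm_wrt Q (a - y))\<^sup>2)) (\<lambda>_. True) p"
    and "g p = ereal \<alpha>" "g y = ereal \<beta>"
  shows "\<alpha> + (a - p) \<bullet> (Q *v (y - p)) \<le> \<beta>"
proof -
  \<comment> \<open>The minimizer is compared with the point at fraction \<open>t\<close> of the
    segment from \<open>p\<close> to \<open>y\<close>. Convexity bounds \<open>g\<close> there;
    division by \<open>t\<close> leaves an error linear in \<open>t\<close>, which vanishes as
    \<open>t\<close> tends to 0 from the right.\<close>
  have small: "\<alpha> - \<beta> + (a - p) \<bullet> (Q *v (y - p)) \<le> t * ((y - p) \<bullet> (Q *v (y - p)) / 2)"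
    if t: "0 < t" "t < 1" for t
  proof -
    define z where "z = (1 - t) *\<^sub>R p + t *\<^sub>R y"
    have az: "a - z = (a - p) - t *\<^sub>R (y - p)"
      by (simp add: z_def algebra_simps)
    have "g z \<le> ereal (1 - t) * g p + ereal t * g y"
      using g t unfolding convex_fun_def z_def by (auto dest: spec)
    also have "\<dots> = ereal ((1 - t) * \<alpha> + t * \<beta>)" using assms(4,5) by simp
    finally have "g z + ereal (1/2 * (norm_wrt Q (a - z))\<^sup>2)
        \<le> ereal ((1 - t) * \<alpha> + t * \<beta>) + ereal (1/2 * (norm_wrt Q (a - z))\<^sup>2)"
      by (rule add_right_mono)
    moreover have "g p + ereal (1/2 * (norm_wrt Q (a - p))\<^sup>2) \<le> g z + ereal (1/2 * (norm_wrt Q (a - z))\<^sup>2)"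
      using min by (auto simp: is_arg_min_def not_less)
    ultimately have "g p + ereal (1/2 * (norm_wrt Q (a - p))\<^sup>2)
        \<le> ereal ((1 - t) * \<alpha> + t * \<beta>) + ereal (1/2 * (norm_wrt Q (a - z))\<^sup>2)"
      by (rule order_trans[rotated])
    then have "\<alpha> + 1/2 * (norm_wrt Q (a - p))\<^sup>2 \<le> (1 - t) * \<alpha> + t * \<beta> + 1/2 * (norm_wrt Q (a - z))\<^sup>2"
      using assms(4) by simp
    then have "t * (\<alpha> - \<beta> + (a - p) \<bullet> (Q *v (y - p))) \<le> t * (t * ((y - p) \<bullet> (Q *v (y - p)) / 2))"
      unfolding norm_wrt_power2[OF Q] az quadratic_form_diff[OF Q, of "a - p" "t *\<^sub>R (y - p)"]
      by (simp add: matrix_vector_mult_scaleR algebra_simps)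
    then show ?thesis using t by (simp del: right_diff_distrib)
  qed
  have "((\<lambda>t. t * ((y - p) \<bullet> (Q *v (y - p)) / 2)) \<longlongrightarrow> 0 * ((y - p) \<bullet> (Q *v (y - p)) / 2)) (at_right 0)"
    by (intro tendsto_intros)
  moreover have "\<forall>\<^sub>F t in at_right (0::real). 0 < t \<and> t < 1"
    unfolding eventually_at_right_field by (intro exI[of _ 1]) auto
  then have "\<forall>\<^sub>F t in at_right 0. \<alpha> - \<beta> + (a - p) \<bullet> (Q *v (y - p)) \<le> t * ((y - p) \<bullet> (Q *v (y - p)) / 2)"
    by (rule eventually_mono) (use small in blast)
  ultimately have "\<alpha> - \<beta> + (a - p) \<bullet> (Q *v (y - p)) \<le> 0 * ((y - p) \<bullet> (Q *v (y - p)) / 2)"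
    by (intro tendsto_lowerbound) auto
  then show ?thesis by simp
qed

text \<open>Each variational inequality is tested at the other minimizer and the two are added. The
  formulation for arbitrary minimizers, rather than for \<open>prox\<close>, lets the case
  \<open>a = b\<close> yield uniqueness.\<close>

lemma arg_min_firmly_nonexpansive:
  fixes g :: "real^'d \<Rightarrow> ereal"
  assumes Q: "positive_definite Q" and g: "convex_fun g"
    and p: "is_arg_min (\<lambda>y. g y + ereal (1/2 * (norm_wrt Q (a - y))\<^sup>2)) (\<lambda>_. True) p" "\<bar>g p\<bar> \<noteq> \<infinity>"
    and q: "is_arg_min (\<lambda>y. g y + ereal (1/2 * (norm_wrt Q (b - y))\<^sup>2)) (\<lambda>_. True) q" "\<bar>g q\<bar> \<noteq> \<infinity>"
  shows "(p - q) \<bullet> (Q *v (p - q)) \<le> (a - b) \<bullet> (Q *v (p - q))"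
proof -
  obtain \<alpha> \<beta> where "g p = ereal \<alpha>" "g q = ereal \<beta>" using p(2) q(2) by auto
  then have "\<alpha> + (a - p) \<bullet> (Q *v (q - p)) \<le> \<beta>" "\<beta> + (b - q) \<bullet> (Q *v (p - q)) \<le> \<alpha>"
    using prox_variational_ineq[OF Q g p(1)] prox_variational_ineq[OF Q g q(1)] by auto
  moreover have "(a - p) \<bullet> (Q *v (q - p)) = - ((a - p) \<bullet> (Q *v (p - q)))"
    by (simp add: matrix_vector_mult_diff_distrib inner_diff_right)
  ultimately show ?thesis by (simp add: inner_diff_left)
qed

text \<open>The compact set \<open>S\<close> contains the effective domain of \<open>g\<close>, so
  minimizers exist by compactness.\<close>

locale prox_setting =
  fixes Q :: "real^'d^'d" and g :: "real^'d \<Rightarrow> ereal" and S :: "(real^'d) set"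
  assumes Q: "positive_definite Q"
    and proper: "proper_fun g" and lsc: "lower_semicontinuous g" and convex: "convex_fun g"
    and compact: "compact S" and outside: "\<And>x. x \<notin> S \<Longrightarrow> g x = \<infinity>"
begin

lemma not_MInfty: "g x \<noteq> -\<infinity>"
  using proper by (simp add: proper_fun_def)

lemma is_arg_min_finite:
  assumes "is_arg_min (\<lambda>y. g y + ereal (1/2 * (norm_wrt Q (a - y))\<^sup>2)) (\<lambda>_. True) p"
  shows "\<bar>g p\<bar> \<noteq> \<infinity>"
proof -
  obtain w where w: "g w \<noteq> \<infinity>" using proper by (auto simp: proper_fun_def)
  have "g p + ereal (1/2 * (norm_wrt Q (a - p))\<^sup>2) \<le> g w + ereal (1/2 * (norm_wrt Q (a - w))\<^sup>2)"
    using assms by (auto simp: is_arg_min_def not_less)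
  then have "g p \<noteq> \<infinity>" using w by auto
  then show ?thesis using not_MInfty[of p] by auto
qed

text \<open>This justifies the definite description in \<open>prox\<close>: a minimizer exists
  because the objective is lower semicontinuous on \<open>S\<close> and infinite outside it, and two
  minimizers coincide by firm nonexpansiveness.\<close>

lemma prox_is_arg_min:
  "is_arg_min (\<lambda>y. g y + ereal (1/2 * (norm_wrt Q (a - y))\<^sup>2)) (\<lambda>_. True) (prox Q g a)"
proof -
  let ?F = "\<lambda>y. g y + ereal (1/2 * (norm_wrt Q (a - y))\<^sup>2)"
  obtain w where "g w \<noteq> \<infinity>" using proper by (auto simp: proper_fun_def)
  then have "S \<noteq> {}" using outside by blast
  have "continuous_on UNIV (\<lambda>y. ereal (1/2 * ((a - y) \<bullet> (Q *v (a - y)))))"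
    by (intro continuous_intros continuous_on_compose2[OF matrix_vector_mult_linear_continuous_on]) auto
  then have "lower_semicontinuous ?F"
    unfolding norm_wrt_power2[OF Q]
    by (intro lower_semicontinuous_add lsc not_MInfty lower_semicontinuous_continuous) auto
  then obtain p where "p \<in> S" and p_min: "\<And>y. y \<in> S \<Longrightarrow> ?F p \<le> ?F y"
    using lower_semicontinuous_attains_inf compact \<open>S \<noteq> {}\<close> by blast
  have "?F p \<le> ?F y" for y
    using p_min[of y] by (cases "y \<in> S") (simp_all add: outside)
  then have p: "is_arg_min ?F (\<lambda>_. True) p"
    by (simp add: is_arg_min_def not_less)
  moreover have "q = p" if q: "is_arg_min ?F (\<lambda>_. True) q" for q
  proof -
    have "(q - p) \<bullet> (Q *v (q - p)) \<le> 0"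
      using arg_min_firmly_nonexpansive[OF Q convex q is_arg_min_finite[OF q] p is_arg_min_finite[OF p]]
      by simp
    then show ?thesis
      using positive_definite_nonneg[OF Q, of "q - p"] positive_definite_eq_0_iff[OF Q, of "q - p"]
      by (simp add: order_antisym)
  qed
  ultimately show ?thesis
    unfolding prox_def by (rule theI)
qed

lemma prox_in: "prox Q g a \<in> S"
  using is_arg_min_finite[OF prox_is_arg_min, of a] outside by force

lemma prox_firmly_nonexpansive:
  "(prox Q g a - prox Q g b) \<bullet> (Q *v (prox Q g a - prox Q g b))
    \<le> (a - b) \<bullet> (Q *v (prox Q g a - prox Q g b))"
  by (rule arg_min_firmly_nonexpansive[OF Q convex prox_is_arg_min is_arg_min_finite[OF prox_is_arg_min]
        prox_is_arg_min is_arg_min_finite[OF prox_is_arg_min]])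

text \<open>Firm nonexpansiveness in the \<open>Q\<close>-norm becomes a Euclidean Lipschitz bound
  \<open>K / c\<close>, with \<open>c\<close> from coercivity and \<open>K\<close> bounding the
  operator norm of \<open>Q\<close>.\<close>

lemma prox_continuous: "continuous_on UNIV (prox Q g)"
proof -
  obtain c where c: "0 < c" "\<And>x. c * (norm x)\<^sup>2 \<le> x \<bullet> (Q *v x)"
    using positive_definite_coercive[OF Q] by blast
  obtain K where K: "0 < K" "\<And>x. norm (Q *v x) \<le> norm x * K"
    using bounded_linear.pos_bounded[OF matrix_vector_mul_bounded_linear] by blast
  have "norm (prox Q g a - prox Q g b) \<le> K / c * norm (a - b)" for a b
  proof -
    let ?v = "prox Q g a - prox Q g b"
    have "c * (norm ?v)\<^sup>2 \<le> (a - b) \<bullet> (Q *v ?v)"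
      using c(2) prox_firmly_nonexpansive order_trans by blast
    also have "\<dots> \<le> norm (a - b) * norm (Q *v ?v)"
      by (rule norm_cauchy_schwarz)
    also have "\<dots> \<le> norm (a - b) * (norm ?v * K)"
      using K(2) by (intro mult_left_mono) auto
    finally have "norm ?v * (c * norm ?v) \<le> norm ?v * (K * norm (a - b))"
      by (simp add: power2_eq_square mult_ac)
    then have "?v = 0 \<or> c * norm ?v \<le> K * norm (a - b)"
      by (metis mult_le_cancel_left_pos zero_less_norm_iff)
    then show ?thesis
      using c(1) K(1) by (auto simp: field_simps)
  qed
  then have "(K / c)-lipschitz_on UNIV (prox Q g)"
    using c(1) K(1) by (intro lipschitz_onI) (auto simp: dist_norm)
  then show ?thesis by (rule lipschitz_on_continuous_on)
qed

text \<open>The gain \<open>c\<close> is the smaller of those of \<open>A\<close> and of the proximal map, which are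
  \<open>(1 - \<eta>) / \<eta>\<close> and \<open>1\<close>; half of it is lost when the residual of the composition is split
  into the two residuals.\<close>
lemma prox_averaged_step:
  fixes A :: "real^'d^'d" and \<eta> :: real
  assumes \<eta>: "0 < \<eta>" "\<eta> < 1"
    and A: "\<And>u. \<eta> * ((A *v u) \<bullet> (Q *v (A *v u))) + (1 - \<eta>) * ((u - A *v u) \<bullet> (Q *v (u - A *v u)))
      \<le> \<eta> * (u \<bullet> (Q *v u))"
    and z: "prox Q g (A *v z) = z"
  defines "c \<equiv> min 1 ((1 - \<eta>) / \<eta>) / 2"
  shows "(prox Q g (A *v x) - z) \<bullet> (Q *v (prox Q g (A *v x) - z))
      + c * ((x - prox Q g (A *v x)) \<bullet> (Q *v (x - prox Q g (A *v x))))
    \<le> (x - z) \<bullet> (Q *v (x - z))"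
proof -
  let ?q = "\<lambda>v. v \<bullet> (Q *v v)"
  define u where "u = x - z"
  define u' where "u' = prox Q g (A *v x) - z"
  have c: "0 \<le> c" "2 * c \<le> 1" "2 * c \<le> (1 - \<eta>) / \<eta>"
    using \<eta> by (auto simp: c_def)
  have "?q u' \<le> (A *v u) \<bullet> (Q *v u')"
    using prox_firmly_nonexpansive[of "A *v x" "A *v z"]
    by (simp add: u_def u'_def z matrix_vector_mult_diff_distrib)
  \<comment> \<open>Firm nonexpansiveness in residual form, obtained by expanding the square of
    \<open>A *v u - u'\<close>.\<close>
  then have firm: "?q u' + ?q (A *v u - u') \<le> ?q (A *v u)"
    unfolding quadratic_form_diff[OF Q, of "A *v u"] by simp
  have "?q (A *v u) + (1 - \<eta>) / \<eta> * ?q (u - A *v u) \<le> ?q u"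
    using A[of u] \<eta>(1) by (simp add: field_simps)
  moreover have "2 * c * ?q (u - A *v u) \<le> (1 - \<eta>) / \<eta> * ?q (u - A *v u)"
    by (intro mult_right_mono c positive_definite_nonneg[OF Q])
  moreover have "2 * c * ?q (A *v u - u') \<le> 1 * ?q (A *v u - u')"
    by (intro mult_right_mono c positive_definite_nonneg[OF Q])
  \<comment> \<open>The residual \<open>u - u'\<close> is split at \<open>A *v u\<close>; the factor
    2 is the reason for bounding \<open>2 * c\<close> above.\<close>
  moreover have "c * ?q (u - u') \<le> c * (2 * ?q (u - A *v u) + 2 * ?q (A *v u - u'))"
    using quadratic_form_add_le[OF Q, of "u - A *v u" "A *v u - u'"] c(1)
    by (intro mult_left_mono) simp_all
  ultimately have "?q u' + c * ?q (u - u') \<le> ?q u"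
    using firm by (simp add: algebra_simps)
  then show ?thesis by (simp add: u_def u'_def)
qed

end

section \<open>Convergence of averaged iterations\<close>

lemma averaged_iteration_converges:
  fixes Q :: "real^'d^'d"
  assumes Q: "positive_definite Q" and "compact S" "convex S" "S \<noteq> {}"
    and T: "continuous_on UNIV T" "\<And>x. T x \<in> S"
    and "0 < c"
    and averaged: "\<And>x z. T z = z \<Longrightarrow>
      (T x - z) \<bullet> (Q *v (T x - z)) + c * ((x - T x) \<bullet> (Q *v (x - T x)))
        \<le> (x - z) \<bullet> (Q *v (x - z))"
    and x: "\<And>k. x (Suc k) = T (x k)"
  obtains z where "T z = z" "x \<longlonglongrightarrow> z"
proof -
  let ?q = "\<lambda>v. v \<bullet> (Q *v v)"
  have q_cont: "continuous_on UNIV ?q"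
    by (intro continuous_intros matrix_vector_mult_linear_continuous_on)
  have q_tendsto: "(\<lambda>n. ?q (u n)) \<longlonglongrightarrow> ?q v" if "u \<longlonglongrightarrow> v" for u v
    using continuous_on_tendsto_compose[OF q_cont that] by simp
  have T_tendsto: "(\<lambda>n. T (u n)) \<longlonglongrightarrow> T v" if "u \<longlonglongrightarrow> v" for u v
    using continuous_on_tendsto_compose[OF T(1) that] by simp
  have decreasing: "decseq (\<lambda>k. ?q (x k - z))" if "T z = z" for z
  proof (rule decseq_SucI)
    fix k
    have "0 \<le> c * ?q (x k - T (x k))"
      using positive_definite_nonneg[OF Q] \<open>0 < c\<close> by simp
    then show "?q (x (Suc k) - z) \<le> ?q (x k - z)"
      using averaged[OF that, of "x k"] by (simp add: x)
  qed
  \<comment> \<open>The shift by one makes every term a value of \<open>T\<close>, hence a point of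
    \<open>S\<close>.\<close>
  have in_S: "\<forall>n. x (Suc n) \<in> S" using T(2) by (simp add: x)
  obtain w r where r: "strict_mono r" and lim: "((\<lambda>n. x (Suc n)) \<circ> r) \<longlonglongrightarrow> w"
    by (rule seq_compactE[OF compact_imp_seq_compact[OF \<open>compact S\<close>] in_S])
  have lim: "(\<lambda>n. x (Suc (r n))) \<longlonglongrightarrow> w" using lim by (simp add: comp_def)
  obtain z where z: "T z = z"
    using brouwer[OF \<open>compact S\<close> \<open>convex S\<close> \<open>S \<noteq> {}\<close> continuous_on_subset[OF T(1) subset_UNIV]] T(2)
    by blast
  obtain L where L: "(\<lambda>k. ?q (x k - z)) \<longlonglongrightarrow> L"
    using decseq_convergent[OF decreasing[OF z], of 0] positive_definite_nonneg[OF Q] by blast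
  have sub: "(\<lambda>n. ?q (x (Suc (r n)) - z)) \<longlonglongrightarrow> L"
    using LIMSEQ_subseq_LIMSEQ[OF LIMSEQ_Suc[OF L] r] by (simp add: comp_def)
  have sub_Suc: "(\<lambda>n. ?q (x (Suc (Suc (r n))) - z)) \<longlonglongrightarrow> L"
    using LIMSEQ_subseq_LIMSEQ[OF LIMSEQ_Suc[OF LIMSEQ_Suc[OF L]] r] by (simp add: comp_def)
  \<comment> \<open>Passing to the limit in the averaged inequality along the subsequence: the
    distances before and after the step share the limit \<open>L\<close>, so the residual at
    \<open>w\<close> must vanish.\<close>
  have "(\<lambda>n. ?q (x (Suc (Suc (r n))) - z) + c * ?q (x (Suc (r n)) - x (Suc (Suc (r n)))))
      \<longlonglongrightarrow> L + c * ?q (w - T w)"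
    unfolding x[of "Suc _"] using sub_Suc[unfolded x[of "Suc _"]] lim
    by (intro tendsto_add tendsto_mult tendsto_const q_tendsto tendsto_diff T_tendsto)
  moreover have "?q (x (Suc (Suc (r n))) - z) + c * ?q (x (Suc (r n)) - x (Suc (Suc (r n))))
      \<le> ?q (x (Suc (r n)) - z)" for n
    using averaged[OF z, of "x (Suc (r n))"] by (simp add: x[of "Suc (r n)"])
  ultimately have "L + c * ?q (w - T w) \<le> L"
    using sub by (intro LIMSEQ_le) auto
  then have "?q (w - T w) \<le> 0" using \<open>0 < c\<close> by (simp add: mult_le_0_iff)
  then have w: "T w = w"
    using positive_definite_nonneg[OF Q, of "w - T w"] positive_definite_eq_0_iff[OF Q, of "w - T w"]
    by (simp add: order_antisym)
  \<comment> \<open>The reference point is now \<open>w\<close> itself. The distances of the whole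
    sequence converge by monotonicity, and the subsequence identifies their limit as 0.\<close>
  obtain L' where L': "(\<lambda>k. ?q (x k - w)) \<longlonglongrightarrow> L'"
    using decseq_convergent[OF decreasing[OF w], of 0] positive_definite_nonneg[OF Q] by blast
  have "(\<lambda>n. ?q (x (Suc (r n)) - w)) \<longlonglongrightarrow> L'"
    using LIMSEQ_subseq_LIMSEQ[OF LIMSEQ_Suc[OF L'] r] by (simp add: comp_def)
  moreover have "(\<lambda>n. ?q (x (Suc (r n)) - w)) \<longlonglongrightarrow> ?q (w - w)"
    using lim by (intro q_tendsto tendsto_diff tendsto_const)
  ultimately have "L' = 0" using LIMSEQ_unique by fastforce
  \<comment> \<open>Coercivity turns convergence in the \<open>Q\<close>-norm into Euclidean
    convergence.\<close>
  obtain d where d: "0 < d" "\<And>v. d * (norm v)\<^sup>2 \<le> ?q v"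
    using positive_definite_coercive[OF Q] by blast
  have "(\<lambda>k. ?q (x k - w) / d) \<longlonglongrightarrow> 0"
    using tendsto_divide[OF L' tendsto_const, of d] d(1) \<open>L' = 0\<close> by simp
  then have "(\<lambda>k. (norm (x k - w))\<^sup>2) \<longlonglongrightarrow> 0"
    by (rule real_tendsto_sandwich[OF _ _ tendsto_const, rotated -1])
      (use d in \<open>auto simp: field_simps intro!: always_eventually\<close>)
  then have "(\<lambda>k. norm (x k - w)) \<longlonglongrightarrow> 0"
    by (simp add: power_tendsto_0_iff)
  then have "x \<longlonglongrightarrow> w"
    by (simp add: LIM_zero_iff tendsto_norm_zero_iff)
  with w show thesis by (rule that)
qed

section \<open>Kronecker products with the identity\<close>

text \<open>While \<open>block\<close> fixes the node, \<open>slice\<close> fixes the coordinate. A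
  product of \<open>M\<close> with the identity acts on each slice as \<open>M\<close>, which
  reduces all quadratic forms to sums over coordinates.\<close>

definition slice :: "real^('a::finite \<times> 'b::finite) \<Rightarrow> 'b \<Rightarrow> real^'a" where
  "slice x k = (\<chi> i. x $ (i, k))"

lemma slice_diff: "slice (x - y) k = slice x k - slice y k"
  by (simp add: slice_def vec_eq_iff)

lemma slice_kronecker_mat_1:
  fixes M :: "real^'a^'a" and x :: "real^('a::finite \<times> 'b::finite)"
  shows "slice ((M \<otimes>\<^sub>K (mat 1 :: real^'b^'b)) *v x) k = M *v slice x k"
proof -
  have "(\<Sum>q\<in>UNIV. M $ i $ fst q * mat 1 $ k $ snd q * x $ q) = (\<Sum>j\<in>UNIV. M $ i $ j * x $ (j, k))" for i
  proof -
    have "(\<Sum>q\<in>UNIV. M $ i $ fst q * (mat 1 :: real^'b^'b) $ k $ snd q * x $ q)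
        = (\<Sum>j\<in>UNIV. \<Sum>l\<in>UNIV. M $ i $ j * (mat 1 :: real^'b^'b) $ k $ l * x $ (j, l))"
      unfolding UNIV_Times_UNIV[symmetric] sum.cartesian_product by (simp add: case_prod_unfold)
    also have "\<dots> = (\<Sum>j\<in>UNIV. \<Sum>l\<in>UNIV. if k = l then M $ i $ j * x $ (j, l) else 0)"
      by (intro sum.cong refl) (simp add: mat_def)
    finally show ?thesis by simp
  qed
  then show ?thesis
    by (simp add: slice_def kronecker_def matrix_vector_mult_def vec_eq_iff)
qed

lemma inner_eq_sum_slice: "x \<bullet> y = (\<Sum>k\<in>UNIV. slice x k \<bullet> slice y k)"
proof -
  have "x \<bullet> y = (\<Sum>i\<in>UNIV. \<Sum>k\<in>UNIV. x $ (i, k) * y $ (i, k))"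
    unfolding inner_vec_def UNIV_Times_UNIV[symmetric] sum.cartesian_product
    by (simp add: case_prod_unfold)
  also have "\<dots> = (\<Sum>k\<in>UNIV. slice x k \<bullet> slice y k)"
    by (subst sum.swap) (simp add: slice_def inner_vec_def)
  finally show ?thesis .
qed

lemma inner_kronecker_mat_1:
  fixes M :: "real^'a^'a" and x y :: "real^('a::finite \<times> 'b::finite)"
  shows "x \<bullet> ((M \<otimes>\<^sub>K (mat 1 :: real^'b^'b)) *v y) = (\<Sum>k\<in>UNIV. slice x k \<bullet> (M *v slice y k))"
  by (simp add: inner_eq_sum_slice slice_kronecker_mat_1)

text \<open>The form is the sum of the forms of \<open>Q\<close> over the slices, and a nonzero
  vector has a nonzero slice.\<close>

lemma positive_definite_kronecker_mat_1:
  fixes Q :: "real^'a^'a"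
  assumes "positive_definite Q"
  shows "positive_definite (Q \<otimes>\<^sub>K (mat 1 :: real^'b::finite^'b))"
  unfolding positive_definite_def
proof (intro conjI allI impI)
  have "Q $ i $ j = Q $ j $ i" for i j
    using assms unfolding positive_definite_def transpose_def vec_eq_iff by simp
  then show "transpose (Q \<otimes>\<^sub>K (mat 1 :: real^'b^'b)) = Q \<otimes>\<^sub>K mat 1"
    by (simp add: transpose_def kronecker_def vec_eq_iff mat_def)
next
  fix x :: "real^('a \<times> 'b)" assume "x \<noteq> 0"
  then obtain i k where "x $ (i, k) \<noteq> 0" by (auto simp: vec_eq_iff)
  then have "slice x k \<noteq> 0" by (auto simp: slice_def vec_eq_iff)
  then have "0 < slice x k \<bullet> (Q *v slice x k)"
    using assms by (simp add: positive_definite_def)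
  then show "0 < x \<bullet> ((Q \<otimes>\<^sub>K (mat 1 :: real^'b^'b)) *v x)"
    unfolding inner_kronecker_mat_1
    by (intro sum_pos2[of UNIV k]) (auto simp: positive_definite_nonneg[OF assms])
qed

text \<open>The matrix inequality says that \<open>P\<close> is \<open>\<eta>\<close>-averaged in the norm of \<open>Q\<close>;
  this is the equivalent formulation through the residual \<open>u - P *v u\<close>.\<close>
lemma lmi_imp_averaged:
  assumes Q: "positive_definite Q"
    and lmi: "transpose P ** Q ** P \<preceq>\<^sub>L
      (2 * \<eta> - 1) *\<^sub>R Q + (1 - \<eta>) *\<^sub>R (transpose P ** Q + Q ** P)"
  shows "\<eta> * ((P *v u) \<bullet> (Q *v (P *v u))) + (1 - \<eta>) * ((u - P *v u) \<bullet> (Q *v (u - P *v u)))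
    \<le> \<eta> * (u \<bullet> (Q *v u))"
proof -
  \<comment> \<open>Here \<open>v v* P\<close> is the simplified form of
    \<open>transpose P *v v\<close>; the adjoint moves \<open>P\<close> to the other side.\<close>
  have adj: "u \<bullet> (v v* P) = (P *v u) \<bullet> v" for v
    by (metis dot_lmul_matrix inner_commute)
  have "0 \<le> u \<bullet> (((2 * \<eta> - 1) *\<^sub>R Q + (1 - \<eta>) *\<^sub>R (transpose P ** Q + Q ** P)
      - transpose P ** Q ** P) *v u)"
    using lmi by (simp add: loewner_le_def positive_semidefinite_def)
  also have "\<dots> = (2 * \<eta> - 1) * (u \<bullet> (Q *v u))
      + (1 - \<eta>) * ((P *v u) \<bullet> (Q *v u) + u \<bullet> (Q *v (P *v u)))
      - (P *v u) \<bullet> (Q *v (P *v u))"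
    by (simp add: matrix_vector_mult_diff_rdistrib matrix_vector_mult_add_rdistrib
        scaleR_matrix_vector_assoc[symmetric] inner_diff_right inner_add_right
        matrix_vector_mul_assoc[symmetric] adj distrib_left)
  finally have "(P *v u) \<bullet> (Q *v (P *v u)) \<le> (2 * \<eta> - 1) * (u \<bullet> (Q *v u))
      + 2 * (1 - \<eta>) * (u \<bullet> (Q *v (P *v u)))"
    using positive_definite_sym[OF Q, of "P *v u" u] by (simp add: algebra_simps)
  \<comment> \<open>Expanding the residual square adds \<open>(1 - \<eta>)\<close> times the form at
    \<open>u\<close> and at \<open>P *v u\<close> and subtracts the cross term just bounded.\<close>
  then show ?thesis
    unfolding quadratic_form_diff[OF Q, of u "P *v u"] by (simp add: algebra_simps)
qed

section \<open>The collective cost and the product of the feasible sets\<close>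

lemma continuous_on_block: "continuous_on S (\<lambda>x. block x i)"
  unfolding block_def by (intro continuous_on_vec_lambda continuous_intros)

text \<open>Lower semicontinuity and convexity pass from each local cost to the sum because
  \<open>block\<close> is continuous and linear; the product of the \<open>X i\<close> is the
  compact set containing the effective domain.\<close>

lemma prox_setting_collective:
  fixes X :: "'N::finite \<Rightarrow> (real^'n::finite) set"
  assumes Q: "positive_definite Q"
    and X: "\<And>i. compact (X i)"
    and proper: "\<And>i. proper_fun (local_cost (f i) (X i))"
    and lsc: "\<And>i. lower_semicontinuous (local_cost (f i) (X i))"
    and convex: "\<And>i. convex_fun (local_cost (f i) (X i))"
  shows "prox_setting Q (collective_cost f X) {x. \<forall>i. block x i \<in> X i}"
proof
  have not_MInfty: "local_cost (f i) (X i) y \<noteq> -\<infinity>" for i y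
    using proper[of i] by (simp add: proper_fun_def)
  show "proper_fun (collective_cost f X)"
  proof -
    \<comment> \<open>Points of finite local cost are glued blockwise into one of finite collective
      cost.\<close>
    obtain w where w: "\<And>i. local_cost (f i) (X i) (w i) \<noteq> \<infinity>"
      using proper unfolding proper_fun_def by metis
    have "block (\<chi> p. w (fst p) $ snd p) i = w i" for i
      by (simp add: block_def vec_eq_iff)
    then have "collective_cost f X (\<chi> p. w (fst p) $ snd p) \<noteq> \<infinity>"
      using w by (simp add: collective_cost_def sum_Pinfty)
    moreover have "collective_cost f X x \<noteq> -\<infinity>" for x
      unfolding collective_cost_def by (intro sum_not_MInfty not_MInfty)
    ultimately show ?thesis
      unfolding proper_fun_def by blast
  qed
  show "lower_semicontinuous (collective_cost f X)"
    unfolding collective_cost_def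
    by (intro lower_semicontinuous_sum lower_semicontinuous_compose[OF lsc] continuous_on_block not_MInfty)
  have "block (u *\<^sub>R x + v *\<^sub>R y) i = u *\<^sub>R block x i + v *\<^sub>R block y i" for u v and x y :: "real^('N \<times> 'n)" and i
    by (simp add: block_def vec_eq_iff)
  then show "convex_fun (collective_cost f X)"
    unfolding collective_cost_def using convex
    by (intro convex_fun_sum) (simp add: convex_fun_def)
  show "compact {x. \<forall>i. block x i \<in> X i}"
  proof -
    have "closed {x. \<forall>i. block x i \<in> X i}"
      using closed_vimage[OF compact_imp_closed[OF X] continuous_on_block]
      by (intro closed_Collect_all) (simp add: vimage_def)
    moreover have "\<forall>i. \<exists>B. \<forall>y\<in>X i. norm y \<le> B"
      using X compact_imp_bounded bounded_iff by blast
    then obtain B where B: "\<And>i y. y \<in> X i \<Longrightarrow> norm y \<le> B i" by metis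
    \<comment> \<open>The norm is bounded by the sum of the absolute coordinates, each at most the
      bound of its block.\<close>
    have "norm x \<le> (\<Sum>p\<in>(UNIV :: ('N \<times> 'n) set). B (fst p))" if "\<And>i. block x i \<in> X i" for x :: "real^('N \<times> 'n)"
    proof -
      have "\<bar>x $ p\<bar> \<le> B (fst p)" for p
        using component_le_norm_cart[of "block x (fst p)" "snd p"] B[OF that, of "fst p"]
        by (simp add: block_def)
      then show ?thesis by (auto intro!: order_trans[OF norm_le_l1_cart] sum_mono)
    qed
    then have "bounded {x. \<forall>i. block x i \<in> X i}" by (auto simp: bounded_iff)
    ultimately show ?thesis by (simp add: compact_eq_bounded_closed)
  qed
  show "collective_cost f X x = \<infinity>" if "x \<notin> {x. \<forall>i. block x i \<in> X i}" for x
  proof -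
    obtain i where "block x i \<notin> X i" using \<open>x \<notin> _\<close> by blast
    then have "local_cost (f i) (X i) (block x i) = \<infinity>"
      using not_MInfty[of i "block x i"] by (cases "f i (block x i)") (auto simp: local_cost_def indicator_fun_def)
    then show ?thesis unfolding collective_cost_def by (auto simp: sum_Pinfty)
  qed
qed (fact Q)

lemma convex_block_product:
  fixes X :: "'N::finite \<Rightarrow> (real^'n::finite) set"
  assumes "\<And>i. convex (X i)"
  shows "convex {x. \<forall>i. block x i \<in> X i}"
proof (rule convexI)
  fix x y :: "real^('N \<times> 'n)" and u v :: real
  assume "x \<in> {x. \<forall>i. block x i \<in> X i}" "y \<in> {x. \<forall>i. block x i \<in> X i}" "0 \<le> u" "0 \<le> v" "u + v = 1"
  moreover have "block (u *\<^sub>R x + v *\<^sub>R y) i = u *\<^sub>R block x i + v *\<^sub>R block y i" for i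
    by (simp add: block_def vec_eq_iff)
  ultimately show "u *\<^sub>R x + v *\<^sub>R y \<in> {x. \<forall>i. block x i \<in> X i}"
    using assms by (simp add: convexD)
qed

theorem proposition1:
  fixes X :: "'N::finite \<Rightarrow> (real^'n::finite) set"
    and f :: "'N \<Rightarrow> real^'n \<Rightarrow> ereal"
    and P Qt :: "real^'N^'N"
    and \<eta> :: real
    and x :: "nat \<Rightarrow> real^('N \<times> 'n)"
  assumes "\<And>i. X i \<noteq> {} \<and> compact (X i) \<and> convex (X i)"
    and "\<And>i y. f i y \<noteq> -\<infinity>"
    and "\<And>i. proper_fun (local_cost (f i) (X i))"
    and "\<And>i. lower_semicontinuous (local_cost (f i) (X i))"
    and "\<And>i. convex_fun (local_cost (f i) (X i))"
    and "row_stochastic P"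
    and "0 < Min (range (\<lambda>i. P $ i $ i))"
    and "strongly_connected (matrix_digraph P)"
    and "0 < \<eta>" and "\<eta> < 1"
    and "positive_definite Qt"
    and "transpose P ** Qt ** P \<preceq>\<^sub>L
           (2 * \<eta> - 1) *\<^sub>R Qt + (1 - \<eta>) *\<^sub>R (transpose P ** Qt + Qt ** P)"
    and "\<And>i. block (x 0) i \<in> X i"
    and "\<And>k. x (Suc k) =
           prox (Qt \<otimes>\<^sub>K (mat 1 :: real^'n^'n)) (collective_cost f X)
             ((P \<otimes>\<^sub>K (mat 1 :: real^'n^'n)) *v x k)"
  shows "\<exists>xbar \<in> network_equilibria (Qt \<otimes>\<^sub>K (mat 1 :: real^'n^'n)) (collective_cost f X)
                  (P \<otimes>\<^sub>K (mat 1 :: real^'n^'n)). x \<longlonglongrightarrow> xbar"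
proof -
  let ?Q = "Qt \<otimes>\<^sub>K (mat 1 :: real^'n^'n)" and ?A = "P \<otimes>\<^sub>K (mat 1 :: real^'n^'n)"
  let ?g = "collective_cost f X" and ?S = "{y. \<forall>i. block y i \<in> X i}"
  have Q: "positive_definite ?Q"
    by (rule positive_definite_kronecker_mat_1[OF assms(11)])
  interpret prox_setting ?Q ?g ?S
    using assms by (intro prox_setting_collective Q) auto
  \<comment> \<open>The averaged inequality for \<open>P\<close> is applied to every slice and
    summed over the coordinates.\<close>
  have averaged: "\<eta> * ((?A *v u) \<bullet> (?Q *v (?A *v u))) + (1 - \<eta>) * ((u - ?A *v u) \<bullet> (?Q *v (u - ?A *v u)))
      \<le> \<eta> * (u \<bullet> (?Q *v u))" for u
    unfolding inner_kronecker_mat_1 slice_kronecker_mat_1 slice_diff sum_distrib_left sum.distrib[symmetric]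
    by (intro sum_mono lmi_imp_averaged assms)
  define c where "c = min 1 ((1 - \<eta>) / \<eta>) / 2"
  have "0 < c" using assms(9,10) by (simp add: c_def)
  \<comment> \<open>The starting point \<open>x 0\<close> witnesses that the product is
    nonempty.\<close>
  have S: "?S \<noteq> {}" "convex ?S"
    using assms(1,13) convex_block_product[of X] by auto
  have cont: "continuous_on UNIV (\<lambda>y. prox ?Q ?g (?A *v y))"
    by (rule continuous_on_compose2[OF prox_continuous matrix_vector_mult_linear_continuous_on]) simp
  obtain z where "prox ?Q ?g (?A *v z) = z" "x \<longlonglongrightarrow> z"
    by (rule averaged_iteration_converges[where T = "\<lambda>y. prox ?Q ?g (?A *v y)" and x = x, OF Q compact S(2,1) cont
          prox_in \<open>0 < c\<close> prox_averaged_step[OF assms(9,10) averaged, folded c_def] assms(14)])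
  then show ?thesis
    by (intro bexI[of _ z]) (simp_all add: network_equilibria_def fixed_points_def)
qed

end
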